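(* Let $X$ be a nonempty set equipped with a separated uniformity $\mathscr U$ generated by a nonempty family $\mathscr F$ of pseudometrics with associated collection $\mathscr V$ of basic entourages, let $G$ be a directed graph with $V(G)=X$ and $E(G)\supseteq\Delta(X)$, and let $T:X\to X$ be a mapping. If $T$ satisfies (B1) for the graph $G$, then $T$ satisfies (B1) for the graphs $G^{-1}$ and $\widetilde G$. If $T$ satisfies (B2) for the graph $G$, then $T$ satisfies (B2) for the graphs $G^{-1}$ and $\widetilde G$. In particular, every Banach $G$-contraction is both a Banach $G^{-1}$-contraction and a Banach $\widetilde G$-contraction.
   Context: Uniform structure: $\mathscr U$ is a uniformity on $X$; separated means $\bigcap\mathscr U=\Delta(X)=\{(x,x):x\in X\}$. $\mathscr F$ is a nonempty family of (uniformly continuous) pseudometrics on $X$ generating $\mathscr U$. For a pseudometric $\rho$ and $r>0$ put $V(\rho,r)=\{(x,y)\in X\times X:\rho(x,y)<r\}$. $\mathscr V$ is the collection of all sets $\bigcap_{i=1}^m V(\rho_i,r_i)$ with $m\ge1$, $\rho_i\in\mathscr F$, $r_i>0$; it is a base of $\mathscr U$ and its members are called basic entourages. For $V=\bigcap_{i=1}^mV(\rho_i,r_i)\in\mathscr V$ and $\alpha>0$, put $\alpha V=\bigcap_{i=1}^mV(\rho_i,\alpha r_i)$ (a basic entourage is regarded as given together with such a presentation, and $\alpha V$ is formed from it). Graphs: $G$ has vertex set $X$ and edge set $E(G)\subseteq X\times X$ (directed, no parallel edges) containing all loops. $G^{-1}$ has vertex set $X$ and $E(G^{-1})=\{(x,y):(y,x)\in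 E(G)\}$. $\widetilde G$ has vertex set $X$ and $E(\widetilde G)=\{(x,y):(x,y)\in E(G)\text{ or }(y,x)\in E(G)\}$. Conditions, for a graph $H$ with vertex set $X$: (B1) $(x,y)\in E(H)$ implies $(Tx,Ty)\in E(H)$ for all $x,y\in X$. (B2) There exists $\alpha\in(0,1)$ such that $(x,y)\in V\cap E(H)$ implies $(Tx,Ty)\in\alpha V$ for all $x,y\in X$ and all $V\in\mathscr V$. A mapping satisfying (B1) and (B2) for $H$ is a Banach $H$-contraction. *)

theory Defs
  imports Complex_Main "Graph_Theory.Digraph_Component"
begin

definition pseudometric :: "('a \<Rightarrow> 'a \<Rightarrow> real) \<Rightarrow> bool" where
  "pseudometric \<rho> \<longleftrightarrow>
     (\<forall>x y. 0 \<le> \<rho> x y) \<and> (\<forall>x. \<rho> x x = 0) \<and> (\<forall>x y. \<rho> x y = \<rho> y x) \<and>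
     (\<forall>x y z. \<rho> x z \<le> \<rho> x y + \<rho> y z)"

definition entourages :: "('a::uniform_space \<times> 'a) set set" where
  "entourages = {E. \<forall>\<^sub>F p in uniformity. p \<in> E}"

definition pm_entourage :: "('a \<Rightarrow> 'a \<Rightarrow> real) \<Rightarrow> real \<Rightarrow> ('a \<times> 'a) set" where
  "pm_entourage \<rho> r = {(x, y). \<rho> x y < r}"

text \<open>
  The uniformity generated by a family of pseudometrics is the filter with subbase
  \<open>pm_entourage \<rho> r\<close>, for \<open>\<rho>\<close> in the family and \<open>r > 0\<close>.
\<close>
definition generates_uniformity :: "('a::uniform_space \<Rightarrow> 'a \<Rightarrow> real) set \<Rightarrow> bool" where
  "generates_uniformity F \<longleftrightarrow>
     uniformity = (INF \<rho>\<in>F. INF r\<in>{0<..}. principal (pm_entourage \<rho> r))"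

text \<open>
  The scaled entourage \<open>\<alpha>V\<close> depends on how \<open>V\<close> is written as an intersection, not only on the
  set \<open>V\<close>. A basic entourage is therefore represented by its presentation, the nonempty list
  of the pairs \<open>(\<rho>\<^sub>i, r\<^sub>i)\<close>; \<open>entourage_of\<close> is the set it denotes.
\<close>
type_synonym 'a presentation = "(('a \<Rightarrow> 'a \<Rightarrow> real) \<times> real) list"

definition basic_presentations :: "('a \<Rightarrow> 'a \<Rightarrow> real) set \<Rightarrow> 'a presentation set" where
  "basic_presentations F = {V. V \<noteq> [] \<and> (\<forall>(\<rho>, r) \<in> set V. \<rho> \<in> F \<and> 0 < r)}"

definition entourage_of :: "'a presentation \<Rightarrow> ('a \<times> 'a) set" where
  "entourage_of V = (\<Inter>(\<rho>, r) \<in> set V. pm_entourage \<rho> r)"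

definition scale :: "real \<Rightarrow> 'a presentation \<Rightarrow> 'a presentation" where
  "scale \<alpha> V = map (\<lambda>(\<rho>, r). (\<rho>, \<alpha> * r)) V"

lemma eventually_INF_principal:
  "(\<forall>\<^sub>F x in INF p\<in>I. principal (B p). x \<in> E) \<longleftrightarrow>
     (\<exists>X \<subseteq> I. finite X \<and> (\<Inter>p\<in>X. B p) \<subseteq> E)"
proof -
  have "(\<forall>\<^sub>F x in INF p\<in>X. principal (B p). x \<in> E) \<longleftrightarrow> (\<Inter>p\<in>X. B p) \<subseteq> E" if "finite X" for X
    using that by (simp add: INF_principal_finite eventually_principal subset_eq)
  then show ?thesis
    unfolding eventually_INF[of _ _ I] by (simp cong: conj_cong)
qed

lemma basic_entourages_base:
  fixes F :: "('a::uniform_space \<Rightarrow> 'a \<Rightarrow> real) set"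
  assumes ne: "F \<noteq> {}" and gen: "generates_uniformity F"
  shows "E \<in> entourages \<longleftrightarrow> (\<exists>V \<in> basic_presentations F. entourage_of V \<subseteq> E)"
proof -
  let ?B = "\<lambda>p. pm_entourage (fst p) (snd p) :: ('a \<times> 'a) set"
  have u: "uniformity = (INF p \<in> F \<times> {0<..}. principal (?B p))"
  proof -
    have "(INF p \<in> F \<times> {0<..}. principal (?B p)) =
        (INF \<rho>\<in>F. INF r\<in>{0<..}. principal (pm_entourage \<rho> r))"
      by (rule antisym) (auto intro!: INF_greatest INF_lower2)
    then show ?thesis using gen by (simp add: generates_uniformity_def)
  qed
  have ev: "E \<in> entourages \<longleftrightarrow> (\<exists>X \<subseteq> F \<times> {0<..}. finite X \<and> (\<Inter>p\<in>X. ?B p) \<subseteq> E)"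
    unfolding entourages_def u mem_Collect_eq by (rule eventually_INF_principal)
  have ent: "entourage_of V = (\<Inter>p\<in>set V. ?B p)" for V
    by (simp add: entourage_of_def case_prod_unfold)
  have bp: "V \<in> basic_presentations F \<longleftrightarrow> V \<noteq> [] \<and> set V \<subseteq> F \<times> {0<..}" for V
    by (auto simp: basic_presentations_def)
  show ?thesis
  proof
    assume "E \<in> entourages"
    then obtain X where X: "X \<subseteq> F \<times> {0<..}" "finite X" "(\<Inter>p\<in>X. ?B p) \<subseteq> E"
      using ev by blast
    obtain \<rho> where "\<rho> \<in> F" using ne by blast
    obtain xs where xs: "set xs = X" using X(2) finite_list by blast
    have "(\<rho>, 1) # xs \<in> basic_presentations F"
      using X(1) xs \<open>\<rho> \<in> F\<close> by (simp add: bp)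
    moreover have "entourage_of ((\<rho>, 1) # xs) \<subseteq> E"
      using X(3) xs by (auto simp: ent)
    ultimately show "\<exists>V \<in> basic_presentations F. entourage_of V \<subseteq> E" by blast
  next
    assume "\<exists>V \<in> basic_presentations F. entourage_of V \<subseteq> E"
    then obtain V where "set V \<subseteq> F \<times> {0<..}" "entourage_of V \<subseteq> E" using bp by blast
    then show "E \<in> entourages"
      unfolding ev ent by (intro exI[of _ "set V"]) simp
  qed
qed

definition inverse_graph :: "'a pair_pre_digraph \<Rightarrow> 'a pair_pre_digraph" where
  "inverse_graph G = \<lparr> pverts = pverts G, parcs = (parcs G)\<inverse> \<rparr>"

text \<open>The edges of \<open>mk_symmetric (with_proj G)\<close> are those of \<open>G\<close> together with their reversals.\<close>
abbreviation symmetric_graph :: "'a pair_pre_digraph \<Rightarrow> 'a pair_pre_digraph" where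
  "symmetric_graph G \<equiv> mk_symmetric (with_proj G)"

lemma symmetric_graph_edges:
  "(x, y) \<in> parcs (symmetric_graph G) \<longleftrightarrow> (x, y) \<in> parcs G \<or> (y, x) \<in> parcs G"
proof -
  have "(x, y) \<in> parcs (symmetric_graph G) \<longleftrightarrow>
      (\<exists>e \<in> parcs G. (x, y) = (fst e, snd e) \<or> (x, y) = (snd e, fst e))"
    by (simp add: parcs_mk_symmetric)
  also have "\<dots> \<longleftrightarrow> (x, y) \<in> parcs G \<or> (y, x) \<in> parcs G"
    by (auto simp: Bex_def)
  finally show ?thesis .
qed

definition preserves_edges :: "'a pair_pre_digraph \<Rightarrow> ('a \<Rightarrow> 'a) \<Rightarrow> bool" where
  "preserves_edges H T \<longleftrightarrow> (\<forall>x y. (x, y) \<in> parcs H \<longrightarrow> (T x, T y) \<in> parcs H)"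

definition contracts_edges ::
  "('a \<Rightarrow> 'a \<Rightarrow> real) set \<Rightarrow> 'a pair_pre_digraph \<Rightarrow> ('a \<Rightarrow> 'a) \<Rightarrow> bool" where
  "contracts_edges F H T \<longleftrightarrow>
     (\<exists>\<alpha>. 0 < \<alpha> \<and> \<alpha> < 1 \<and>
       (\<forall>x y. \<forall>V \<in> basic_presentations F.
          (x, y) \<in> entourage_of V \<inter> parcs H \<longrightarrow> (T x, T y) \<in> entourage_of (scale \<alpha> V)))"

definition banach_contraction ::
  "('a \<Rightarrow> 'a \<Rightarrow> real) set \<Rightarrow> 'a pair_pre_digraph \<Rightarrow> ('a \<Rightarrow> 'a) \<Rightarrow> bool" where
  "banach_contraction F H T \<longleftrightarrow> preserves_edges H T \<and> contracts_edges F H T"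

end

theory Submission
  imports Defs
begin

text \<open>Pseudometrics are symmetric, so every basic entourage and all its multiples are symmetric
  relations; the contraction constant of \<open>G\<close> therefore also works for reversed edges.\<close>

lemma inverse_graph_edges: "(x, y) \<in> parcs (inverse_graph G) \<longleftrightarrow> (y, x) \<in> parcs G"
  by (simp add: inverse_graph_def)

lemma mem_entourage_of:
  "(x, y) \<in> entourage_of V \<longleftrightarrow> (\<forall>\<rho> r. (\<rho>, r) \<in> set V \<longrightarrow> \<rho> x y < r)"
  by (simp add: entourage_of_def pm_entourage_def case_prod_beta)
    (metis fst_conv snd_conv surj_pair)

text \<open>Only the pseudometrics listed in the presentation matter here; no condition is put on
  the radii, so the same lemma serves \<open>V\<close> and \<open>scale \<alpha> V\<close>.\<close>

lemma entourage_of_sym: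
  assumes "\<And>\<rho> r. (\<rho>, r) \<in> set V \<Longrightarrow> pseudometric \<rho>"
  shows "(x, y) \<in> entourage_of V \<longleftrightarrow> (y, x) \<in> entourage_of V"
proof -
  have "\<rho> x y = \<rho> y x" if "(\<rho>, r) \<in> set V" for \<rho> r
    using assms[OF that] by (simp add: pseudometric_def)
  then show ?thesis
    unfolding mem_entourage_of by metis
qed

lemma preserves_edges_inverse_graph:
  "preserves_edges G T \<Longrightarrow> preserves_edges (inverse_graph G) T"
  by (simp add: preserves_edges_def inverse_graph_edges)

lemma preserves_edges_symmetric_graph:
  "preserves_edges G T \<Longrightarrow> preserves_edges (symmetric_graph G) T"
  unfolding preserves_edges_def symmetric_graph_edges by blast

text \<open>The hypothesis on \<open>H\<close> is kept loose so that one argument covers the inverse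
  graph and the symmetric graph. The constant of \<open>G\<close> is reused unchanged.\<close>

lemma contracts_edges_subset_symmetric:
  assumes F: "\<And>\<rho>. \<rho> \<in> F \<Longrightarrow> pseudometric \<rho>"
    and G: "contracts_edges F G T"
    and H: "\<And>x y. (x, y) \<in> parcs H \<Longrightarrow> (x, y) \<in> parcs G \<or> (y, x) \<in> parcs G"
  shows "contracts_edges F H T"
proof -
  obtain \<alpha> where \<alpha>: "0 < \<alpha>" "\<alpha> < 1"
    and contr: "\<And>x y V. V \<in> basic_presentations F \<Longrightarrow> (x, y) \<in> entourage_of V \<Longrightarrow>
      (x, y) \<in> parcs G \<Longrightarrow> (T x, T y) \<in> entourage_of (scale \<alpha> V)"
    using G unfolding contracts_edges_def by blast
  have "(T x, T y) \<in> entourage_of (scale \<alpha> V)"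
    if V: "V \<in> basic_presentations F" and xy: "(x, y) \<in> entourage_of V" "(x, y) \<in> parcs H"
    for x y V
  proof (cases "(x, y) \<in> parcs G")
    case True
    with contr V xy show ?thesis by blast
  next
    \<comment> \<open>The edge is a reversal of one in \<open>G\<close>: flip the pair inside
      \<open>V\<close>, contract along the edge \<open>(y, x)\<close> of \<open>G\<close>, and flip
      the image pair back inside \<open>scale \<alpha> V\<close>.\<close>
    case False
    with H xy have "(y, x) \<in> parcs G" by blast
    moreover have "(y, x) \<in> entourage_of V"
    proof -
      have "pseudometric \<rho>" if "(\<rho>, r) \<in> set V" for \<rho> r
        using that V F by (auto simp: basic_presentations_def)
      then show ?thesis
        using xy entourage_of_sym[of V] by blast
    qed
    ultimately have "(T y, T x) \<in> entourage_of (scale \<alpha> V)"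
      using contr V by blast
    \<comment> \<open>Scaling alters only the radii, so the pseudometrics involved are still members
      of \<open>F\<close>.\<close>
    moreover have "pseudometric \<rho>" if "(\<rho>, r) \<in> set (scale \<alpha> V)" for \<rho> r
      using that V F by (auto simp: scale_def basic_presentations_def)
    ultimately show ?thesis
      using entourage_of_sym[of "scale \<alpha> V"] by blast
  qed
  with \<alpha> show ?thesis
    unfolding contracts_edges_def by blast
qed

theorem proposition1:
  fixes F :: "('a::uniform_space \<Rightarrow> 'a \<Rightarrow> real) set"
    and G :: "'a pair_pre_digraph"
    and T :: "'a \<Rightarrow> 'a"
  assumes separated: "\<Inter> (entourages :: ('a \<times> 'a) set set) = Id"
    and F_nonempty: "F \<noteq> {}"
    and F_pseudometrics: "\<And>\<rho>. \<rho> \<in> F \<Longrightarrow> pseudometric \<rho>"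
    and F_generates: "generates_uniformity F"
    and G_graph: "pair_wf_digraph G"
    and G_verts: "pverts G = UNIV"
    and G_loops: "Id \<subseteq> parcs G"
  shows "(preserves_edges G T \<longrightarrow>
            preserves_edges (inverse_graph G) T \<and> preserves_edges (symmetric_graph G) T) \<and>
         (contracts_edges F G T \<longrightarrow>
            contracts_edges F (inverse_graph G) T \<and> contracts_edges F (symmetric_graph G) T) \<and>
         (banach_contraction F G T \<longrightarrow>
            banach_contraction F (inverse_graph G) T \<and>
            banach_contraction F (symmetric_graph G) T)"
proof -
  have "contracts_edges F (inverse_graph G) T" if "contracts_edges F G T"
    using F_pseudometrics that
    \<comment> \<open>Every edge here is a reversed edge of \<open>G\<close>, which is the second
      alternative of the lemma.\<close>
    by (rule contracts_edges_subset_symmetric) (simp_all add: inverse_graph_edges)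
  moreover have "contracts_edges F (symmetric_graph G) T" if "contracts_edges F G T"
    using F_pseudometrics that
    \<comment> \<open>Here both alternatives occur; together they are exactly the description of the
      edges.\<close>
    by (rule contracts_edges_subset_symmetric) (simp_all only: symmetric_graph_edges)
  ultimately show ?thesis
    using preserves_edges_inverse_graph preserves_edges_symmetric_graph
    unfolding banach_contraction_def by blast
qed

end
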